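(* Let $n,w\ge1$ be integers. Let $\mathrm{CDP}(n,w)$ be the set of integer sequences $(a_1,\dots,a_n)$ with $0\le a_i\le w-1$ and $a_{i+1}\le a_i+1$ for all $1\le i\le n$ (where $a_{n+1}:=a_1$), and let $\alpha$ act on $\mathrm{CDP}(n,w)$ by the cyclic shift $(a_1,\dots,a_n)\mapsto(a_n,a_1,\dots,a_{n-1})$, generating a cyclic group $\langle\alpha\rangle$ of order $n$. Let $|\mathrm{CDP}(n,w)|_q=\sum_{(x_0,\mathbf b)}q^{\mathrm{maj}(\mathbf b)}$, summing over all pairs $(x_0,\mathbf b)$ with $x_0\in\{1,\dots,w\}$, $\mathbf b=(b_1,\dots,b_{2n})\in\{0,1\}^{2n}$ having $n$ zeros and $n$ ones and $b_{2n}=1$, such that the lattice path from $(x_0,0)$ taking an east step $(1,0)$ for each $0$ and a north step $(0,1)$ for each $1$ never visits a lattice point on the lines $y=x$ or $y=x-(w+2)$. Then $(\mathrm{CDP}(n,w),\langle\alpha\rangle,|\mathrm{CDP}(n,w)|_q)$ exhibits the cyclic sieving phenomenon.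
   Context: $\mathrm{maj}(\mathbf b)=\sum\{i: b_i>b_{i+1}\}$. A triple $(X,C_n,f(q))$, with $X$ a finite set, $C_n=\langle g\rangle$ a cyclic group of order $n$ acting on $X$, and $f(q)$ a polynomial with non-negative integer coefficients, exhibits the cyclic sieving phenomenon (CSP) if for every $k\in\{1,\dots,n\}$, $f(\omega_n^k)=|\{x\in X: g^k\cdot x=x\}|$, where $\omega_n=e^{2\pi i/n}$ (in particular $f(1)=|X|$). *)

theory Defs
  imports
    "HOL-Algebra.Elementary_Groups"
    "HOL-Algebra.Group_Action"
    "HOL-Computational_Algebra.Polynomial"
    Complex_Main
begin

text \<open>The triple \<open>(X, G, f)\<close> exhibits cyclic sieving, where \<open>G\<close> is a cyclic group of order \<open>n\<close>
  with chosen generator \<open>g\<close>, acting on \<open>X\<close> through \<open>\<phi>\<close>. The action need not be faithful.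
  Non-negativity of the coefficients of \<open>f\<close> is carried by the type \<open>nat poly\<close>.\<close>

definition exhibits_CSP ::
  "'x set \<Rightarrow> ('g, 'm) monoid_scheme \<Rightarrow> nat \<Rightarrow> 'g \<Rightarrow> ('g \<Rightarrow> 'x \<Rightarrow> 'x) \<Rightarrow> nat poly \<Rightarrow> bool"
where
  "exhibits_CSP X G n g \<phi> f \<longleftrightarrow>
     finite X \<and>
     0 < n \<and> Coset.order G = n \<and> g \<in> carrier G \<and> generate G {g} = carrier G \<and>
     group_action G X \<phi> \<and>
     (\<forall>k\<in>{1..n}.
        poly (map_poly of_nat f) (exp (2 * complex_of_real pi * \<i> / of_nat n) ^ k)
          = of_nat (card {x \<in> X. \<phi> (g [^]\<^bsub>G\<^esub> k) x = x}))"

text \<open>The list entry \<open>a ! i\<close> is $a_{i+1}$; the index \<open>Suc i mod n\<close> implements $a_{n+1} := a_1$.\<close>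

definition CDP :: "nat \<Rightarrow> nat \<Rightarrow> int list set" where
  "CDP n w = {a. length a = n \<and>
                 (\<forall>i<n. 0 \<le> a ! i \<and> a ! i \<le> int w - 1) \<and>
                 (\<forall>i<n. a ! (Suc i mod n) \<le> a ! i + 1)}"

definition cyc_shift :: "'a list \<Rightarrow> 'a list" where
  "cyc_shift a = last a # butlast a"

text \<open>The group $C_n$ is \<open>integer_mod_group n\<close> with generator \<open>1 mod int n\<close>, which acts as
  \<open>cyc_shift\<close>. (For \<open>w = 1\<close> the shift is the identity permutation of the set, so $C_n$ cannot be
  taken to be a group of permutations.) The restriction is needed because \<open>group_action\<close> works with
  extensional functions.\<close>

definition CDP_action :: "nat \<Rightarrow> nat \<Rightarrow> int \<Rightarrow> int list \<Rightarrow> int list" where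
  "CDP_action n w k = restrict (cyc_shift ^^ nat k) (CDP n w)"

text \<open>Positions are counted from 1 in the major index, so $b_i > b_{i+1}$ reads
  \<open>b ! (i - 1) > b ! i\<close>.\<close>

definition maj :: "nat list \<Rightarrow> nat" where
  "maj b = \<Sum>{i. 1 \<le> i \<and> i < length b \<and> b ! (i - 1) > b ! i}"

text \<open>The lattice point reached from \<open>(x0, 0)\<close> after \<open>j\<close> steps, 0 being east and 1 north.\<close>

definition path_point :: "int \<Rightarrow> nat list \<Rightarrow> nat \<Rightarrow> int \<times> int" where
  "path_point x0 b j = (x0 + int (count_list (take j b) 0), int (count_list (take j b) 1))"

definition CDP_paths :: "nat \<Rightarrow> nat \<Rightarrow> (int \<times> nat list) set" where
  "CDP_paths n w =
     {(x0, b). x0 \<in> {1..int w} \<and>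
               length b = 2 * n \<and> set b \<subseteq> {0, 1} \<and>
               count_list b 0 = n \<and> count_list b 1 = n \<and> last b = 1 \<and>
               (\<forall>j \<le> 2 * n. \<forall>x y. path_point x0 b j = (x, y) \<longrightarrow>
                   y \<noteq> x \<and> y \<noteq> x - (int w + 2))}"

definition CDP_q :: "nat \<Rightarrow> nat \<Rightarrow> nat poly" where
  "CDP_q n w = (\<Sum>(x0, b) \<in> CDP_paths n w. monom 1 (maj b))"

end

theory Submission
  imports Defs "HOL-Analysis.Complex_Transcendental"
begin

text \<open>
  The height \<open>x - y\<close> of a path stays between \<open>0\<close> and \<open>L = w + 2\<close>, so the sum of \<open>q ^ maj\<close> is evaluated by
  a weighted reflection principle and becomes an alternating sum of Gaussian binomial coefficients.
  At a root of unity \<open>q\<close> of order \<open>m\<close> with \<open>n = m * d\<close>, twice this sum collapses to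
  $\sum_k {2n \brack n + Lk}_q \sum_{x=1}^{L} q^{kx} - \sum_j {2n \brack n+j}_q$, where $k$ and $j$ range
  over all integers. By the \<open>q\<close>-Lucas theorem only
  the terms with \<open>k\<close> and \<open>j\<close> divisible by \<open>m\<close> survive, and they give the same expression for \<open>d\<close> in place
  of \<open>n\<close> and \<open>1\<close> in place of \<open>q\<close>, i.e. the number of paths for \<open>d\<close>. Recording the heights after the
  north steps, in reverse order, identifies the paths for \<open>d\<close> with \<open>CDP d w\<close>, whose elements are exactly
  the periods of the sequences in \<open>CDP n w\<close> that are fixed by a power of the shift of order \<open>m\<close>.
\<close>

section \<open>Gaussian binomial coefficients\<close>

text \<open>Gaussian binomial coefficients. The recursion, unlike the quotient of q-factorials,
  makes sense at roots of unity, and an integer lower index lets reflected indices leave the range,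
  where the value is 0.\<close>

fun qbin :: "'a::field \<Rightarrow> nat \<Rightarrow> int \<Rightarrow> 'a" where
  "qbin q 0 a = (if a = 0 then 1 else 0)"
| "qbin q (Suc N) a = qbin q N a + q powi (int (Suc N) - a) * qbin q N (a - 1)"

lemma qbin_eq_0: "a < 0 \<or> a > int N \<Longrightarrow> qbin q N a = 0"
  by (induction N arbitrary: a) auto

text \<open>The dual Pascal rule. Expanding both terms of the defining recursion by the induction
  hypothesis gives four terms, which regroup into two instances of the recursion once the exponents
  are exchanged as in \<open>1\<close>.\<close>

lemma qbin_Suc': "q \<noteq> 0 \<Longrightarrow> qbin q (Suc N) a = q powi a * qbin q N a + qbin q N (a - 1)"
proof (induction N arbitrary: a)
  case 0
  then show ?case by auto
next
  case (Suc N)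
  have 1: "q powi (int (Suc (Suc N)) - a) * q powi (a - 1) = q powi a * q powi (int (Suc N) - a)"
    using Suc.prems by (simp flip: power_int_add)
  have "qbin q (Suc (Suc N)) a = q powi a * qbin q N a + qbin q N (a - 1)
      + (q powi (int (Suc (Suc N)) - a) * q powi (a - 1) * qbin q N (a - 1)
      + q powi (int (Suc (Suc N)) - a) * qbin q N (a - 1 - 1))"
    by (subst qbin.simps(2), subst (1 2) Suc.IH[OF Suc.prems]) (simp only: distrib_left mult.assoc)
  also have "\<dots> = q powi a * (qbin q N a + q powi (int (Suc N) - a) * qbin q N (a - 1))
      + (qbin q N (a - 1) + q powi (int (Suc N) - (a - 1)) * qbin q N (a - 1 - 1))"
    unfolding 1 by (simp add: algebra_simps)
  also have "\<dots> = q powi a * qbin q (Suc N) a + qbin q (Suc N) (a - 1)"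
    by (simp only: qbin.simps(2))
  finally show ?case .
qed

lemma qbin_sym: "q \<noteq> 0 \<Longrightarrow> qbin q N (int N - a) = qbin q N a"
proof (induction N arbitrary: a)
  case (Suc N)
  have "qbin q (Suc N) (int (Suc N) - a) = qbin q N (int N - (a - 1)) + q powi a * qbin q N (int N - a)"
    by (simp add: algebra_simps)
  also have "\<dots> = qbin q N (a - 1) + q powi a * qbin q N a"
    by (simp only: Suc.IH[OF Suc.prems])
  finally show ?case by (simp only: qbin_Suc'[OF Suc.prems] add.commute)
qed auto

text \<open>Here \<open>q\<close> has multiplicative order \<open>m\<close>. Comparing the two
  Pascal rules for row \<open>m + 1\<close> relates neighbours in row \<open>m\<close> by
  \<open>rel\<close>. The right factor vanishes at \<open>a = 1\<close> and the left factor at no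
  \<open>a\<close> strictly between 0 and \<open>m\<close>, so the interior entries are 0.\<close>

lemma qbin_root_row:
  assumes "q \<noteq> 0" and m: "m > 0" "\<And>i. q powi i = 1 \<longleftrightarrow> int m dvd i"
  shows "qbin q m a = (if a = 0 then 1 else 0) + (if a = int m then 1 else 0)"
proof -
  have rel: "(1 - q powi a) * qbin q m a = (1 - q powi (1 - a)) * qbin q m (a - 1)" for a
  proof -
    have "q powi (int (Suc m) - a) = q powi (int m) * q powi (1 - a)"
      using \<open>q \<noteq> 0\<close> by (simp add: power_int_add[symmetric] algebra_simps del: power_int_of_nat)
    also have "q powi (int m) = 1" using m(2)[of "int m"] by simp
    finally have "q powi (int (Suc m) - a) = q powi (1 - a)" by simp
    then show ?thesis using qbin_Suc'[OF \<open>q \<noteq> 0\<close>, of m a] by (simp add: algebra_simps)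
  qed
  have z: "qbin q m (int i) = 0" if "0 < i" "i < m" for i
    using that
  proof (induction i)
    case (Suc i)
    have "(1 - q powi (1 - int (Suc i))) * qbin q m (int (Suc i) - 1) = 0"
      using Suc by (cases "i = 0") auto
    then have "(1 - q powi int (Suc i)) * qbin q m (int (Suc i)) = 0" by (simp only: rel)
    moreover have "\<not> int m dvd int (Suc i)" using Suc.prems by (meson nat_dvd_not_less of_nat_dvd_iff)
    ultimately show ?case using m(2)[of "int (Suc i)"] by auto
  qed auto
  have one: "qbin q N 0 = 1" for N by (induction N) (auto simp: qbin_eq_0)
  have top: "qbin q m (int m) = 1" using qbin_sym[OF \<open>q \<noteq> 0\<close>, of m 0] one by simp
  consider "a < 0 \<or> a > int m" | "a = 0" | "a = int m" | "0 < a" "a < int m" by linarith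
  then show ?thesis
  proof cases
    case 4
    then show ?thesis using z[of "nat a"] by auto
  qed (use m(1) one top in \<open>auto simp: qbin_eq_0\<close>)
qed

text \<open>The powers of \<open>q\<close> have period \<open>m\<close>, so shifting the lower index
  by \<open>m\<close> respects the Pascal recursion, and row \<open>m\<close> starts the
  induction.\<close>

lemma qbin_add_root:
  assumes "q \<noteq> 0" and m: "m > 0" "\<And>i. q powi i = 1 \<longleftrightarrow> int m dvd i"
  shows "qbin q (N + m) a = qbin q N a + qbin q N (a - int m)"
proof (induction N arbitrary: a)
  case 0
  show ?case using qbin_root_row[OF assms] by simp
next
  case (Suc N)
  have per: "q powi (i + int m) = q powi i" for i
    using m(2)[of "int m"] \<open>q \<noteq> 0\<close> by (simp add: power_int_add)
  have "qbin q (Suc N + m) a = qbin q (N + m) a + q powi (int (Suc N) - a + int m) * qbin q (N + m) (a - 1)"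
    by (simp add: algebra_simps)
  also have "\<dots> = qbin q N a + q powi (int (Suc N) - a) * qbin q N (a - 1)
      + (qbin q N (a - int m) + q powi (int (Suc N) - a) * qbin q N (a - 1 - int m))"
    by (simp only: Suc per) (simp add: algebra_simps)
  also have "q powi (int (Suc N) - a) = q powi (int (Suc N) - (a - int m))"
    using per[of "int (Suc N) - a"] by (simp add: algebra_simps)
  finally show ?case using per[of "int (Suc N) - a"] by (simp add: algebra_simps)
qed

text \<open>The q-Lucas theorem for upper indices divisible by \<open>m\<close>: a block of
  \<open>m\<close> rows acts as one row of the ordinary Pascal triangle.\<close>

lemma qbin_mult_root:
  assumes "q \<noteq> 0" and m: "m > 0" "\<And>i. q powi i = 1 \<longleftrightarrow> int m dvd i"
  shows "qbin q (m * N) a = (if int m dvd a then qbin 1 N (a div int m) else 0)"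
proof (induction N arbitrary: a)
  case 0
  show ?case using m(1) by (auto simp: dvd_div_eq_0_iff)
next
  case (Suc N)
  have "qbin q (m * Suc N) a = qbin q (m * N) a + qbin q (m * N) (a - int m)"
    using qbin_add_root[OF assms, of "m * N"] by (simp add: add.commute)
  also have "\<dots> = (if int m dvd a then qbin 1 (Suc N) (a div int m) else 0)"
  proof (cases "int m dvd a")
    case True
    then have "int m dvd a - int m" "(a - int m) div int m = a div int m - 1"
      using m(1) by (auto elim!: dvdE simp: right_diff_distrib[symmetric] algebra_simps)
    then show ?thesis using True by (simp add: Suc)
  next
    case False
    then have "\<not> int m dvd a - int m" by (simp add: dvd_diff_left_iff)
    with False show ?thesis by (simp add: Suc)
  qed
  finally show ?case .
qed

section \<open>Reflected sums\<close>

text \<open>The sums of \<open>q ^ maj\<close> over all words of length \<open>N\<close> with \<open>a\<close> zeros that end in 0,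
  respectively in 1. The empty word counts as ending in 0.\<close>

definition free0 :: "'a::field \<Rightarrow> nat \<Rightarrow> int \<Rightarrow> 'a" where
  "free0 q N a = (if N = 0 then qbin q 0 a else q powi (int N - a) * qbin q (N - 1) (a - 1))"

definition free1 :: "'a::field \<Rightarrow> nat \<Rightarrow> int \<Rightarrow> 'a" where
  "free1 q N a = (if N = 0 then 0 else qbin q (N - 1) a)"

lemma free_add: "free0 q N a + free1 q N a = qbin q N a"
  by (cases N) (auto simp: free0_def free1_def)

text \<open>The left side is the sum over the words after a further 0 is appended, which makes a
  descent at \<open>N\<close> exactly after a final 1. The dual Pascal rule turns it into a single
  term.\<close>

lemma free_add_weighted:
  assumes "q \<noteq> 0"
  shows "free0 q N a + q ^ N * free1 q N a = q powi (int N - a) * qbin q N a"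
proof (cases N)
  case (Suc M)
  have "q ^ N = q powi (int N - a) * q powi a"
    using assms by (simp add: power_int_add[symmetric])
  then show ?thesis
    using qbin_Suc'[OF assms, of M a] Suc
    by (simp add: free0_def free1_def algebra_simps del: qbin.simps)
qed (auto simp: free0_def free1_def)

lemma free0_Suc:
  "q \<noteq> 0 \<Longrightarrow> free0 q (Suc N) a = free0 q N (a - 1) + q ^ N * free1 q N (a - 1)"
  by (simp add: free_add_weighted) (simp add: free0_def algebra_simps)

lemma free1_Suc: "free1 q (Suc N) a = free0 q N a + free1 q N a"
  unfolding free_add by (simp add: free1_def)

lemma sum_int_telescope:
  fixes u :: "int \<Rightarrow> 'a::ab_group_add"
  assumes "a \<le> b + 1"
  shows "(\<Sum>k=a..b. u (k + 1) - u k) = u (b + 1) - u a"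
proof -
  have "(\<Sum>k=a..c - 1. u (k + 1) - u k) = u c - u a" if "a \<le> c" for c
    using that
  proof (induction rule: int_ge_induct)
    case (step i)
    then have "{a..i + 1 - 1} = insert i {a..i - 1}" by auto
    with step show ?case by simp
  qed simp
  from this[of "b + 1"] assms show ?thesis by simp
qed

text \<open>Signed superposition of the images of the starting point \<open>x\<close> under the reflections in \<open>0\<close>
  and \<open>L\<close>. Appending 0 to a word of length \<open>N\<close> ending in 1 costs \<open>q ^ N\<close>, so the superposition must
  satisfy \<open>G0 + q ^ N * G1 = 0\<close> at height \<open>0\<close> but \<open>G0 + G1 = 0\<close> at height \<open>L\<close>. The first condition
  makes the coefficients at \<open>s\<close> and \<open>-s\<close> differ by the factor \<open>- q powi s\<close>, the second makes those at
  \<open>s\<close> and \<open>2 * L - s\<close> opposite; this determines the weights. The bound \<open>K\<close> only cuts off images that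
  are too far away to contribute.\<close>

definition reflected ::
  "('a::field \<Rightarrow> nat \<Rightarrow> int \<Rightarrow> 'a) \<Rightarrow> 'a \<Rightarrow> int \<Rightarrow> int \<Rightarrow> int \<Rightarrow> nat \<Rightarrow> int \<Rightarrow> 'a" where
  "reflected g q L K x N a =
     (\<Sum>k=-K..K. q powi (k * x + L * k * (k - 1)) * (g q N (a - L * k) - g q N (a + x + L * (k - 1))))"

lemma reflected_add:
  "reflected free0 q L K x N a + c * reflected free1 q L K x N a =
     reflected (\<lambda>q N a. free0 q N a + c * free1 q N a) q L K x N a"
  unfolding reflected_def sum_distrib_left sum.distrib[symmetric]
  by (rule sum.cong) (auto simp: algebra_simps)

text \<open>At height \<open>L\<close> the symmetry of the binomials identifies the two images with
  the same \<open>k\<close>, so every summand vanishes.\<close>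

lemma reflected_top:
  assumes "q \<noteq> 0" "x + 2 * a - int N = L"
  shows "reflected free0 q L K x N a + reflected free1 q L K x N a = 0"
proof -
  have "qbin q N (a - L * k) = qbin q N (a + x + L * (k - 1))" for k
    using qbin_sym[OF assms(1), of N "a + x + L * (k - 1)"]
    by (simp add: assms(2)[symmetric] algebra_simps)
  then show ?thesis
    using reflected_add[of q L K x N a 1] by (simp add: free_add) (simp add: reflected_def)
qed

text \<open>At height 0 the symmetry matches the direct image for \<open>k\<close> with the
  reflected image for \<open>k + 1\<close>, weights included. The sum telescopes, and the bound on
  \<open>N\<close> puts both end terms outside the range of the binomial.\<close>

lemma reflected_bottom:
  assumes "q \<noteq> 0" "x + 2 * a = int N" "0 < x" "x < L" "int N \<le> L * K" "K \<ge> 0"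
  shows "reflected free0 q L K x N a + q ^ N * reflected free1 q L K x N a = 0"
proof -
  define u where "u k = q powi (k * x + L * k * (k - 1)) *
    (q powi (int N - (a + x + L * (k - 1))) * qbin q N (a + x + L * (k - 1)))" for k
  have u_Suc: "q powi (k * x + L * k * (k - 1)) * (q powi (int N - (a - L * k)) * qbin q N (a - L * k)) = u (k + 1)" for k
  proof -
    have "qbin q N (a - L * k) = qbin q N (a + x + L * k)"
      using qbin_sym[OF assms(1), of N "a + x + L * k"] by (simp add: assms(2)[symmetric] algebra_simps)
    moreover have "q powi (k * x + L * k * (k - 1)) * q powi (int N - (a - L * k))
        = q powi ((k + 1) * x + L * (k + 1) * (k + 1 - 1)) * q powi (int N - (a + x + L * (k + 1 - 1)))"
      unfolding power_int_add[OF disjI1[OF assms(1)], symmetric]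
      by (rule arg_cong[where f = "power_int q"]) (simp add: assms(2)[symmetric] algebra_simps)
    ultimately show ?thesis by (simp add: u_def mult.assoc[symmetric])
  qed
  have "reflected (\<lambda>q N a. q powi (int N - a) * qbin q N a) q L K x N a = (\<Sum>k=-K..K. u (k + 1) - u k)"
    unfolding reflected_def
    by (intro sum.cong refl, unfold u_Suc[symmetric], unfold u_def, simp only: right_diff_distrib)
  also have "\<dots> = u (K + 1) - u (- K)"
    by (rule sum_int_telescope) (use assms in auto)
  also have "u (K + 1) = 0"
    using assms by (auto simp: u_def intro!: qbin_eq_0)
  also have "u (- K) = 0"
  proof -
    have "a + x + L * (- K - 1) = a + x - L * K - L" by (simp add: algebra_simps)
    then have "a + x + L * (- K - 1) < 0" using assms by linarith
    then show ?thesis by (simp add: u_def qbin_eq_0)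
  qed
  finally have "reflected (\<lambda>q N a. q powi (int N - a) * qbin q N a) q L K x N a = 0" by simp
  then show ?thesis
    unfolding reflected_add unfolding reflected_def free_add_weighted[OF assms(1)] .
qed

lemma reflected_free0_Suc:
  "q \<noteq> 0 \<Longrightarrow> reflected free0 q L K x (Suc N) a =
     reflected free0 q L K x N (a - 1) + q ^ N * reflected free1 q L K x N (a - 1)"
  unfolding reflected_add unfolding reflected_def free0_Suc by (simp add: algebra_simps)

lemma reflected_free1_Suc:
  "reflected free1 q L K x (Suc N) a = reflected free0 q L K x N a + reflected free1 q L K x N a"
  using reflected_add[of q L K x N a 1] by (simp add: reflected_def free1_Suc)

lemma reflected_free1_0: "reflected free1 q L K x 0 a = 0"
  by (simp add: reflected_def free1_def)

text \<open>For the empty word only a lower index 0 contributes. Since start and end lie strictly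
  between 0 and \<open>L\<close>, this leaves the direct image with \<open>k = 0\<close>.\<close>

lemma reflected_free0_0:
  assumes "0 < x" "x < L" "0 < x + 2 * a" "x + 2 * a < L" "K \<ge> 0"
  shows "reflected free0 q L K x 0 a = (if a = 0 then 1 else 0)"
proof -
  have *: "k = 0" if "a = L * k" for k
  proof (rule ccontr)
    assume "k \<noteq> 0"
    then consider "k \<ge> 1" | "k \<le> -1" by linarith
    then show False
    proof cases
      case 1
      then have "L * 1 \<le> L * k" using assms by (intro mult_left_mono) auto
      then show False using assms that by linarith
    next
      case 2
      then have "L * k \<le> L * -1" using assms by (intro mult_left_mono) auto
      then show False using assms that by linarith
    qed
  qed
  have **: "a + x + L * (k - 1) \<noteq> 0" for k
  proof
    assume eq: "a + x + L * (k - 1) = 0"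
    consider "k \<ge> 1" | "k \<le> 0" by linarith
    then show False
    proof cases
      case 1
      then have "L * 0 \<le> L * (k - 1)" using assms by (intro mult_left_mono) auto
      then show False using assms eq by linarith
    next
      case 2
      then have "L * (k - 1) \<le> L * -1" using assms by (intro mult_left_mono) auto
      then show False using assms eq by linarith
    qed
  qed
  have "reflected free0 q L K x 0 a = (\<Sum>k=-K..K. if k = 0 then (if a = 0 then 1 else 0) else 0)"
    unfolding reflected_def
    by (rule sum.cong) (use * ** in \<open>auto simp: free0_def\<close>)
  then show ?thesis using assms by simp
qed

section \<open>Words in a strip\<close>

definition height :: "int \<Rightarrow> nat list \<Rightarrow> int" where
  "height x b = x + int (count_list b 0) - int (count_list b 1)"

definition inside :: "int \<Rightarrow> int \<Rightarrow> nat list \<Rightarrow> bool" where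
  "inside x L b \<longleftrightarrow> (\<forall>j\<le>length b. 0 < height x (take j b) \<and> height x (take j b) < L)"

lemma inside_snoc:
  "inside x L (b @ [c]) \<longleftrightarrow> inside x L b \<and> 0 < height x (b @ [c]) \<and> height x (b @ [c]) < L"
  by (auto simp: inside_def le_Suc_eq all_conj_distrib)

lemma inside_height: "inside x L b \<Longrightarrow> 0 < height x b \<and> height x b < L"
  by (auto simp: inside_def dest: spec[of _ "length b"])

lemma maj_Nil [simp]: "maj [] = 0"
  by (simp add: maj_def)

text \<open>The 0 in front makes the empty word count as ending in 0, so that a first letter is
  never a descent.\<close>

lemma maj_snoc: "maj (b @ [c]) = maj b + (if last (0 # b) > c then length b else 0)"
proof -
  have "{i. 1 \<le> i \<and> i < length (b @ [c]) \<and> (b @ [c]) ! (i - 1) > (b @ [c]) ! i}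
      = {i. 1 \<le> i \<and> i < length b \<and> b ! (i - 1) > b ! i}
        \<union> (if last (0 # b) > c then {length b} else {})"
    by (auto simp: nth_append last_conv_nth less_Suc_eq split: if_splits)
  then show ?thesis by (auto simp: maj_def)
qed

definition strip_words :: "int \<Rightarrow> int \<Rightarrow> nat \<Rightarrow> int \<Rightarrow> nat \<Rightarrow> nat list set" where
  "strip_words x L N a l = {b. length b = N \<and> set b \<subseteq> {0, 1} \<and> int (count_list b 0) = a \<and>
     inside x L b \<and> last (0 # b) = l}"

lemma finite_strip_words [simp]: "finite (strip_words x L N a l)"
proof (rule finite_subset)
  show "strip_words x L N a l \<subseteq> {b. set b \<subseteq> {0, 1} \<and> length b = N}" by (auto simp: strip_words_def)
qed (simp add: finite_lists_length_eq)

lemma count_list_01: "set b \<subseteq> {0, 1} \<Longrightarrow> count_list b (0::nat) + count_list b 1 = length b"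
  by (induction b) auto

lemma strip_words_height:
  assumes "b \<in> strip_words x L N a l"
  shows "0 < x + 2 * a - int N \<and> x + 2 * a - int N < L"
proof -
  have "height x b = x + 2 * a - int N"
    using assms count_list_01[of b] by (auto simp: strip_words_def height_def)
  then show ?thesis using assms inside_height[of x L b] by (auto simp: strip_words_def)
qed

lemma strip_words_Suc:
  assumes "l \<in> {0, 1}" "0 < x + 2 * a - int (Suc N)" "x + 2 * a - int (Suc N) < L"
  shows "strip_words x L (Suc N) a l =
    (\<lambda>b. b @ [l]) ` (strip_words x L N (a + int l - 1) 0 \<union> strip_words x L N (a + int l - 1) 1)"
    (is "?A = ?f ` ?B")
proof (intro Set.equalityI subsetI)
  fix b assume b: "b \<in> ?A"
  then obtain c where c: "b = c @ [l]"
    by (cases b rule: rev_cases) (auto simp: strip_words_def)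
  have "set c \<subseteq> {0, 1}" using b c by (auto simp: strip_words_def)
  then have "last (0 # c) = 0 \<or> last (0 # c) = 1"
    using last_in_set[of "0 # c"] by auto
  with b c assms(1) show "b \<in> ?f ` ?B"
    by (auto simp: strip_words_def inside_snoc)
next
  fix b assume "b \<in> ?f ` ?B"
  then obtain c where c: "b = c @ [l]" "c \<in> ?B" by auto
  have "height x b = x + 2 * a - int (Suc N)"
    using assms(1) c count_list_01[of c] by (auto simp: strip_words_def height_def)
  with assms c show "b \<in> ?A" by (auto simp: strip_words_def inside_snoc)
qed

definition strip_sum :: "'a::field \<Rightarrow> int \<Rightarrow> int \<Rightarrow> nat \<Rightarrow> int \<Rightarrow> nat \<Rightarrow> 'a" where
  "strip_sum q x L N a l = (\<Sum>b\<in>strip_words x L N a l. q ^ maj b)"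

lemma strip_sum_Suc:
  assumes "l \<in> {0, 1}" "0 < x + 2 * a - int (Suc N)" "x + 2 * a - int (Suc N) < L"
  shows "strip_sum q x L (Suc N) a l = strip_sum q x L N (a + int l - 1) 0
    + (if l = 0 then q ^ N else 1) * strip_sum q x L N (a + int l - 1) 1"
proof -
  let ?B = "\<lambda>l'. strip_words x L N (a + int l - 1) l'"
  have "strip_sum q x L (Suc N) a l = (\<Sum>b\<in>?B 0 \<union> ?B 1. q ^ maj (b @ [l]))"
    unfolding strip_sum_def strip_words_Suc[OF assms]
    by (subst sum.reindex) (auto simp: inj_on_def)
  also have "\<dots> = (\<Sum>b\<in>?B 0. q ^ maj (b @ [l])) + (\<Sum>b\<in>?B 1. q ^ maj (b @ [l]))"
    by (rule sum.union_disjoint) (simp_all, auto simp: strip_words_def)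
  also have "(\<Sum>b\<in>?B 0. q ^ maj (b @ [l])) = strip_sum q x L N (a + int l - 1) 0"
    unfolding strip_sum_def by (rule sum.cong) (auto simp: maj_snoc strip_words_def)
  also have "(\<Sum>b\<in>?B 1. q ^ maj (b @ [l])) = (if l = 0 then q ^ N else 1) * strip_sum q x L N (a + int l - 1) 1"
    unfolding strip_sum_def sum_distrib_left
    by (rule sum.cong) (use assms(1) in \<open>auto simp: maj_snoc strip_words_def power_add mult.commute\<close>)
  finally show ?thesis .
qed

text \<open>Both sides have the same initial values and the same recursion in \<open>N\<close>. The
  induction hypothesis is missing only where the predecessor lies on height 0 or \<open>L\<close>:
  there the strip sums are empty and the reflected combinations vanish. The boundary is met only at
  the preceding length, hence the \<open>+ 1\<close> in the bound.\<close>

lemma strip_sum_reflected: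
  assumes "q \<noteq> 0" "0 < x" "x < L" "int N \<le> L * K + 1" "K \<ge> 0"
    and "0 < x + 2 * a - int N" "x + 2 * a - int N < L"
  shows "strip_sum q x L N a 0 = reflected free0 q L K x N a
    \<and> strip_sum q x L N a 1 = reflected free1 q L K x N a"
  using assms(4,6,7)
proof (induction N arbitrary: a)
  case 0
  have "strip_words x L 0 a 0 = (if a = 0 then {[]} else {})" "strip_words x L 0 a 1 = {}"
    using assms by (auto simp: strip_words_def inside_def height_def)
  then show ?case
    using 0 assms by (simp add: strip_sum_def reflected_free1_0 reflected_free0_0)
next
  case (Suc N)
  have NK: "int N \<le> L * K + 1" "int N \<le> L * K" using Suc.prems by auto
  have empty: "strip_sum q x L N c l = 0" if "x + 2 * c - int N = 0 \<or> x + 2 * c - int N = L" for c l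
  proof -
    have "strip_words x L N c l = {}" using strip_words_height[of _ x L N c l] that by auto
    then show ?thesis by (simp add: strip_sum_def)
  qed
  have "strip_sum q x L N (a - 1) 0 + q ^ N * strip_sum q x L N (a - 1) 1
      = reflected free0 q L K x (Suc N) a"
  proof (cases "x + 2 * (a - 1) - int N = 0")
    case True
    then show ?thesis
      using reflected_bottom[of q x "a - 1" N L K] empty[of "a - 1"] assms NK
      by (simp add: reflected_free0_Suc)
  next
    case False
    then show ?thesis using Suc.IH[of "a - 1"] Suc.prems NK assms(1) by (simp add: reflected_free0_Suc)
  qed
  moreover have "strip_sum q x L N a 0 + strip_sum q x L N a 1 = reflected free1 q L K x (Suc N) a"
  proof (cases "x + 2 * a - int N = L")
    case True
    then show ?thesis
      using reflected_top[of q x a N L K] empty[of a] assms by (simp add: reflected_free1_Suc)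
  next
    case False
    then show ?thesis using Suc.IH[of a] Suc.prems NK by (simp add: reflected_free1_Suc)
  qed
  ultimately show ?case
    using strip_sum_Suc[of 0 x a N L q] strip_sum_Suc[of 1 x a N L q] Suc.prems by simp
qed

section \<open>Reflected sums at roots of unity\<close>

lemma sum_uminus_interval:
  fixes K :: int
  shows "(\<Sum>k=-K..K. g (- k)) = (\<Sum>k=-K..K. g k)"
  by (rule sum.reindex_bij_witness[of _ uminus uminus]) auto

text \<open>Division with remainder by \<open>L\<close>, with the remainders shifted from 0..L-1 to
  1..L.\<close>

lemma sum_int_blocks:
  fixes L :: int
  assumes "L > 0"
  shows "(\<Sum>k=a..b. \<Sum>x=1..L. g (x + L * (k - 1))) = (\<Sum>j=L * (a - 1) + 1..L * b. g j)"
proof -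
  have "(\<Sum>k=a..b. \<Sum>x=1..L. g (x + L * (k - 1))) =
      (\<Sum>(k, x)\<in>{a..b} \<times> {1..L}. g (x + L * (k - 1)))"
    by (simp add: sum.cartesian_product)
  also have "\<dots> = (\<Sum>j=L * (a - 1) + 1..L * b. g j)"
  proof (rule sum.reindex_bij_witness[of _ "\<lambda>j. ((j - 1) div L + 1, (j - 1) mod L + 1)"
        "\<lambda>(k, x). x + L * (k - 1)"])
    fix p assume "p \<in> {a..b} \<times> {1..L}"
    then obtain k x where p: "p = (k, x)" "a \<le> k" "k \<le> b" "1 \<le> x" "x \<le> L" by auto
    have "(x - 1 + L * (k - 1)) div L = k - 1" "(x - 1 + L * (k - 1)) mod L = x - 1"
      using p assms by auto
    then show "(((case p of (k, x) \<Rightarrow> x + L * (k - 1)) - 1) div L + 1,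
        ((case p of (k, x) \<Rightarrow> x + L * (k - 1)) - 1) mod L + 1) = p"
      using p by (simp add: algebra_simps)
    have "L * (a - 1) \<le> L * (k - 1)" "L * (k - 1) \<le> L * (b - 1)"
      using p assms by (auto intro!: mult_left_mono)
    moreover have "L * (b - 1) = L * b - L" by (simp add: algebra_simps)
    ultimately show "(case p of (k, x) \<Rightarrow> x + L * (k - 1)) \<in> {L * (a - 1) + 1..L * b}"
      using p(4,5) unfolding p(1) prod.case atLeastAtMost_iff by linarith
  next
    fix j assume j: "j \<in> {L * (a - 1) + 1..L * b}"
    have "a - 1 \<le> (j - 1) div L"
      using zdiv_mono1[of "L * (a - 1)" "j - 1" L] j assms by simp
    moreover have "L * ((j - 1) div L) < L * b"
      using j mult_div_mod_eq[of L "j - 1"] pos_mod_sign[OF assms, of "j - 1"]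
      unfolding atLeastAtMost_iff by linarith
    then have "(j - 1) div L < b" using assms by simp
    moreover have "0 \<le> (j - 1) mod L" "(j - 1) mod L < L" using assms by auto
    ultimately show "((j - 1) div L + 1, (j - 1) mod L + 1) \<in> {a..b} \<times> {1..L}" by auto
    show "(case ((j - 1) div L + 1, (j - 1) mod L + 1) of (k, x) \<Rightarrow> x + L * (k - 1)) = j"
      using mult_div_mod_eq[of L "j - 1"] by simp
  qed auto
  finally show ?thesis .
qed

text \<open>Everything is pushed onto \<open>E j = qbin q (2 * n) (int n + j)\<close>: since \<open>q ^ n = 1\<close>, the Pascal rule and
  the symmetry give \<open>X (- j) = E j - q powi j * X j\<close> for \<open>X j = qbin q (2 * n - 1) (int n + j)\<close>, so
  pairing \<open>k\<close> with \<open>-k\<close> in the first sum and \<open>j\<close> with \<open>-j\<close> in the second leaves the same remainder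
  \<open>R\<close> in both.\<close>

lemma sum_reflected_closed:
  fixes q :: "'a::field" and L :: int and n :: nat
  assumes q: "q \<noteq> 0" "q ^ n = 1" and "L > 0" "n > 0"
    and fixed: "\<And>j. q powi j * qbin q (2 * n) (int n + j) = qbin q (2 * n) (int n + j)"
  shows "2 * (\<Sum>x=1..L. reflected free1 q L (int n + 1) x (2 * n) (int n)) =
    (\<Sum>k=-int n..int n. qbin q (2 * n) (int n + L * k) * (\<Sum>x=1..L. q powi (k * x)))
      - (\<Sum>j=-int n..int n. qbin q (2 * n) (int n + j))"
proof -
  \<comment> \<open>The cutoff must exceed \<open>n\<close>: for \<open>L = 1\<close> the index at
    the lower end can be as large as \<open>- K\<close>, and \<open>X (- n)\<close> is not
    0.\<close>
  define K where "K = int n + 1"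
  define X where "X j = qbin q (2 * n - 1) (int n + j)" for j
  define E where "E j = qbin q (2 * n) (int n + j)" for j
  define V where "V k = (\<Sum>x=1..L. q powi (k * x))" for k
  have padd: "q powi (i + j) = q powi i * q powi j" for i j
    using q(1) by (simp add: power_int_add)
  have qn: "q powi (int n) = 1" using q(2) by simp
  have X0: "X j = 0" if "j \<ge> int n \<or> j < - int n" for j
    unfolding X_def by (rule qbin_eq_0) (use that \<open>n > 0\<close> in auto)
  have E0: "E j = 0" if "j > int n \<or> j < - int n" for j
    unfolding E_def by (rule qbin_eq_0) (use that in auto)
  have LK: "L * k \<ge> k" if "k \<ge> 0" for k
    using mult_right_mono[of 1 L k] \<open>L > 0\<close> that by simp
  have LK': "L * k \<le> k" if "k \<le> 0" for k
    using mult_right_mono_neg[of 1 L k] \<open>L > 0\<close> that by simp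
  \<comment> \<open>The hypothesis \<open>fixed\<close> extends from \<open>j\<close> to all its
    integer multiples, so such exponents may be dropped in front of \<open>E j\<close>.\<close>
  have E_fixed: "q powi i * E j = E j" if "j dvd i" for i j
  proof -
    have 1: "q powi (j * int t) * E j = E j" for t
    proof (induction t)
      case (Suc t)
      have "q powi (j * int (Suc t)) * E j = q powi (j * int t) * (q powi j * E j)"
        by (simp add: distrib_left padd mult_ac)
      also have "q powi j * E j = E j" unfolding E_def by (rule fixed)
      finally show ?case by (simp only: Suc)
    qed simp
    from that obtain c where c: "i = j * c" by blast
    show ?thesis
    proof (cases "c \<ge> 0")
      case True
      then show ?thesis using 1[of "nat c"] c by simp
    next
      case False
      have "q powi (- i) * E j = E j" using 1[of "nat (- c)"] False c by simp
      then have "q powi i * E j = q powi i * q powi (- i) * E j" by (simp only: mult.assoc)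
      also have "q powi i * q powi (- i) = 1" unfolding padd[symmetric] by simp
      finally show ?thesis by simp
    qed
  qed
  have X_sym: "X (- j) = X (j - 1)" for j
    using qbin_sym[OF q(1), of "2 * n - 1" "int n + j - 1"] \<open>n > 0\<close>
    by (simp add: X_def of_nat_diff algebra_simps)
  have X_pascal: "E j = X j + q powi (- j) * X (j - 1)" for j
  proof -
    have "2 * n = Suc (2 * n - 1)" using \<open>n > 0\<close> by simp
    then have "E j = X j + q powi (int (Suc (2 * n - 1)) - (int n + j)) * X (j - 1)"
      unfolding E_def X_def by (metis qbin.simps(2) add_diff_eq)
    also have "int (Suc (2 * n - 1)) - (int n + j) = int n + - j" using \<open>n > 0\<close> by simp
    finally show ?thesis by (simp only: padd qn mult_1)
  qed
  have X_refl: "X (- j) = E j - q powi j * X j" for j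
  proof -
    have "q powi j * E j = q powi j * X j + (q powi j * q powi (- j)) * X (j - 1)"
      unfolding X_pascal[of j] by (simp add: algebra_simps)
    then show ?thesis using E_fixed[of j j] by (simp add: X_sym padd[symmetric])
  qed
  have E_sym: "E (- j) = E j" for j
    using qbin_sym[OF q(1), of "2 * n" "int n + j"] by (simp add: E_def)

  \<comment> \<open>\<open>a k\<close> collects the direct images over all starting points,
    \<open>s k x\<close> is a single reflected image.\<close>
  define s where "s k x = q powi (k * (x + L * (k - 1))) * X (x + L * (k - 1))" for k x
  define a where "a k = q powi (L * k * (k - 1)) * V k * X (- (L * k))" for k
  define S where "S = (\<Sum>k=-K..K. \<Sum>x=1..L. s k x)"
  define R where "R = (\<Sum>k=-K..K. q powi (L * k * k) * X (L * k) * (1 - q powi (L * k)))"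

  have "(\<Sum>x=1..L. reflected free1 q L K x (2 * n) (int n)) =
      (\<Sum>x=1..L. \<Sum>k=-K..K. q powi (k * x + L * k * (k - 1)) * X (- (L * k)) - s k x)"
    unfolding reflected_def
    by (intro sum.cong refl)
      (use \<open>n > 0\<close> in \<open>auto simp: free1_def X_def s_def algebra_simps\<close>)
  also have "\<dots> = (\<Sum>k=-K..K. \<Sum>x=1..L. q powi (k * x + L * k * (k - 1)) * X (- (L * k)) - s k x)"
    by (rule sum.swap)
  also have "\<dots> = (\<Sum>k=-K..K. a k) - S"
    by (simp add: sum_subtractf S_def a_def V_def padd sum_distrib_left sum_distrib_right mult_ac)
  finally have main: "(\<Sum>x=1..L. reflected free1 q L K x (2 * n) (int n)) = (\<Sum>k=-K..K. a k) - S" .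

  \<comment> \<open>\<open>X_refl\<close> expresses \<open>X (- (L * k))\<close> through
    \<open>X (L * k)\<close>. The two coefficients of \<open>X (L * k)\<close> then differ by a
    geometric sum times its ratio minus one, which is evaluated by telescoping.\<close>
  have a_pair: "a k + a (- k) = E (L * k) * V k + q powi (L * k * k) * X (L * k) * (1 - q powi (L * k))" for k
  proof -
    have V_neg: "V (- k) = q powi (- k * (L + 1)) * V k"
    proof -
      have "V (- k) = (\<Sum>x=1..L. q powi (- k * (L + 1 - x)))"
        unfolding V_def
        by (rule sum.reindex_bij_witness[of _ "\<lambda>x. L + 1 - x" "\<lambda>x. L + 1 - x"]) auto
      also have "\<dots> = q powi (- k * (L + 1)) * V k"
        unfolding V_def sum_distrib_left padd[symmetric] by (simp add: algebra_simps)
      finally show ?thesis .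
    qed
    have V_tel: "q powi (- k) * V k - V k = 1 - q powi (L * k)"
    proof -
      have "V k - q powi (- k) * V k = (\<Sum>x=1..L. q powi (k * (x + 1 - 1)) - q powi (k * (x - 1)))"
        unfolding V_def sum_distrib_left sum_subtractf padd[symmetric] by (simp add: algebra_simps)
      also have "\<dots> = q powi (k * (L + 1 - 1)) - q powi (k * (1 - 1))"
        by (rule sum_int_telescope) (use \<open>L > 0\<close> in auto)
      finally show ?thesis by (simp add: algebra_simps)
    qed
    have 1: "q powi (L * k * (k - 1)) * E (L * k) = E (L * k)"
      by (rule E_fixed) auto
    have 2: "q powi (L * k * (k - 1)) * q powi (L * k) = q powi (L * k * k)"
      unfolding padd[symmetric] by (simp add: algebra_simps)
    have 3: "q powi (L * (- k) * (- k - 1)) * q powi (- k * (L + 1)) = q powi (L * k * k) * q powi (- k)"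
      unfolding padd[symmetric] by (simp add: algebra_simps)
    have "a k = (q powi (L * k * (k - 1)) * E (L * k)) * V k
        - (q powi (L * k * (k - 1)) * q powi (L * k)) * X (L * k) * V k"
      unfolding a_def X_refl by (simp add: algebra_simps)
    then have "a k = E (L * k) * V k - q powi (L * k * k) * X (L * k) * V k"
      unfolding 1 2 .
    moreover have "a (- k) = (q powi (L * (- k) * (- k - 1)) * q powi (- k * (L + 1))) * V k * X (L * k)"
      unfolding a_def V_neg by (simp add: mult_ac)
    then have "a (- k) = q powi (L * k * k) * X (L * k) * (q powi (- k) * V k)"
      unfolding 3 by (simp add: mult_ac)
    ultimately have "a k + a (- k) = E (L * k) * V k
        + q powi (L * k * k) * X (L * k) * (q powi (- k) * V k - V k)"
      by (simp add: algebra_simps)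
    then show ?thesis unfolding V_tel .
  qed
  have "2 * (\<Sum>k=-K..K. a k) = (\<Sum>k=-K..K. a k + a (- k))"
    by (simp add: sum.distrib sum_uminus_interval)
  then have A2: "2 * (\<Sum>k=-K..K. a k) = (\<Sum>k=-K..K. E (L * k) * V k) + R"
    unfolding a_pair by (simp add: R_def sum.distrib)

  \<comment> \<open>Negating the index \<open>x + L * (k - 1)\<close> means replacing
    \<open>k\<close> by \<open>1 - k\<close> and \<open>x\<close> by \<open>L - x\<close>.\<close>
  have s_refl: "s k x = E (x + L * (k - 1)) - s (1 - k) (L - x)" for k x
  proof -
    define j where "j = x + L * (k - 1)"
    have j': "L - x + L * (1 - k - 1) = - j" by (simp add: j_def algebra_simps)
    have "X j = E j - q powi (- j) * X (- j)" using X_refl[of "- j"] by (simp add: E_sym)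
    then have "s k x = q powi (k * j) * E j - q powi (k * j) * q powi (- j) * X (- j)"
      unfolding s_def j_def[symmetric] by (simp only: right_diff_distrib mult.assoc)
    also have "q powi (k * j) * q powi (- j) = q powi ((1 - k) * - j)"
      unfolding padd[symmetric] by (simp add: algebra_simps)
    also have "q powi (k * j) * E j = E j" by (rule E_fixed) auto
    finally show ?thesis unfolding s_def j' unfolding j_def .
  qed
  have s_edge: "s (K + 1) x = 0" if "x \<ge> 0" for x
  proof -
    have "L * K \<ge> K" by (rule LK) (simp add: K_def)
    then have "x + L * (K + 1 - 1) \<ge> int n"
      using that unfolding add_diff_cancel_right' K_def by linarith
    then show ?thesis by (simp add: s_def X0)
  qed
  have s_edge': "s (- K) x = 0" if "x \<le> L" for x
  proof -
    have "x + L * (- K - 1) \<le> - (L * K)" using that by (simp add: algebra_simps)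
    moreover have "L * K \<ge> K" by (rule LK) (simp add: K_def)
    ultimately have "x + L * (- K - 1) < - int n" using K_def by linarith
    then show ?thesis by (simp add: s_def X0)
  qed
  \<comment> \<open>As \<open>x\<close> runs through 1..L, \<open>L - x\<close> runs through 0..L-1.
    Hence \<open>t\<close> is the inner sum of \<open>S\<close> moved down by one, and the two
    differ only by the terms at \<open>L\<close> and 0.\<close>
  define t where "t k = (\<Sum>x=1..L. s k (x - 1))" for k
  have "S = (\<Sum>k=-K..K. \<Sum>x=1..L. E (x + L * (k - 1))) - (\<Sum>k=-K..K. \<Sum>x=1..L. s (1 - k) (L - x))"
    unfolding S_def sum_subtractf[symmetric] by (intro sum.cong refl s_refl)
  also have "(\<Sum>k=-K..K. \<Sum>x=1..L. s (1 - k) (L - x)) = (\<Sum>k=-K..K. t (1 - k))"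
    unfolding t_def
    by (rule sum.cong[OF refl], rule sum.reindex_bij_witness[of _ "\<lambda>x. L + 1 - x" "\<lambda>x. L + 1 - x"]) auto
  also have "\<dots> = (\<Sum>k=-K..K. t (k + 1))"
    by (subst sum_uminus_interval[symmetric]) (simp add: add.commute)
  also have "\<dots> = (\<Sum>k=-K..K. t k)"
  proof -
    have "(\<Sum>k=-K..K. t (k + 1)) - (\<Sum>k=-K..K. t k) = t (K + 1) - t (- K)"
      unfolding sum_subtractf[symmetric] by (rule sum_int_telescope) (simp add: K_def)
    also have "\<dots> = 0" unfolding t_def by (simp add: s_edge s_edge')
    finally show ?thesis by simp
  qed
  finally have S_add_t: "S + (\<Sum>k=-K..K. t k) = (\<Sum>k=-K..K. \<Sum>x=1..L. E (x + L * (k - 1)))" by simp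
  have S_diff_t: "(\<Sum>k=-K..K. \<Sum>x=1..L. s k (x + 1 - 1) - s k (x - 1)) = S - (\<Sum>k=-K..K. t k)"
    by (simp add: S_def t_def sum_subtractf)
  have "2 * S = (\<Sum>k=-K..K. \<Sum>x=1..L. E (x + L * (k - 1)))
      + (\<Sum>k=-K..K. \<Sum>x=1..L. s k (x + 1 - 1) - s k (x - 1))"
    unfolding S_diff_t S_add_t[symmetric] by simp
  also have "(\<Sum>k=-K..K. \<Sum>x=1..L. s k (x + 1 - 1) - s k (x - 1)) = (\<Sum>k=-K..K. s k L - s k 0)"
  proof (rule sum.cong[OF refl])
    fix k
    show "(\<Sum>x=1..L. s k (x + 1 - 1) - s k (x - 1)) = s k L - s k 0"
      by (subst sum_int_telescope) (use \<open>L > 0\<close> in auto)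
  qed
  \<comment> \<open>Replacing \<open>k\<close> by \<open>k + 1\<close> in \<open>s k 0\<close> gives
    the same index \<open>L * k\<close> as in \<open>s k L\<close>, with an extra factor
    \<open>q powi (L * k)\<close>.\<close>
  also have "\<dots> = R"
  proof -
    have "s k L = q powi (L * k * k) * X (L * k)" for k
      by (simp add: s_def algebra_simps)
    moreover have "s (k + 1) 0 = q powi (L * k * k) * X (L * k) * q powi (L * k)" for k
      by (simp add: s_def algebra_simps padd)
    moreover have "(\<Sum>k=-K..K. s (k + 1) 0) - (\<Sum>k=-K..K. s k 0) = s (K + 1) 0 - s (- K) 0"
      unfolding sum_subtractf[symmetric] by (rule sum_int_telescope) (simp add: K_def)
    then have "(\<Sum>k=-K..K. s k 0) = (\<Sum>k=-K..K. s (k + 1) 0)"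
      using \<open>L > 0\<close> by (simp add: s_edge s_edge')
    ultimately show ?thesis by (simp add: R_def sum_subtractf right_diff_distrib)
  qed
  also have "(\<Sum>k=-K..K. \<Sum>x=1..L. E (x + L * (k - 1))) = (\<Sum>j=-int n..int n. E j)"
  proof -
    have "L * (- K - 1) \<le> - K - 1" by (rule LK') (simp add: K_def)
    moreover have "L * K \<ge> K" by (rule LK) (simp add: K_def)
    ultimately have "L * (- K - 1) + 1 \<le> - int n" "int n \<le> L * K"
      using K_def by linarith+
    then show ?thesis
      unfolding sum_int_blocks[OF \<open>L > 0\<close>]
      by (intro sum.mono_neutral_right) (auto intro!: E0)
  qed
  finally have S2: "2 * S = (\<Sum>j=-int n..int n. E j) + R" .

  have "E (L * k) = 0" if "k \<in> {-K..K} - {-int n..int n}" for k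
  proof (rule E0)
    from that have "k < - int n \<or> k > int n" by auto
    then show "L * k > int n \<or> L * k < - int n" using LK[of k] LK'[of k] by linarith
  qed
  then have "(\<Sum>k=-K..K. E (L * k) * V k) = (\<Sum>k=-int n..int n. E (L * k) * V k)"
    by (intro sum.mono_neutral_right) (auto simp: K_def)
  then have "2 * ((\<Sum>k=-K..K. a k) - S) =
      (\<Sum>k=-int n..int n. E (L * k) * V k) - (\<Sum>j=-int n..int n. E j)"
    unfolding right_diff_distrib A2 S2 by simp
  then show ?thesis
    unfolding main[unfolded K_def, symmetric] E_def V_def K_def by simp
qed

lemma sum_int_multiples:
  fixes m d :: nat
  assumes "m > 0"
  shows "(\<Sum>k=-int (m * d)..int (m * d). if int m dvd k then g (k div int m) else 0) = (\<Sum>i=-int d..int d. g i)"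
proof -
  have "(\<Sum>k=-int (m * d)..int (m * d). if int m dvd k then g (k div int m) else 0)
      = (\<Sum>k\<in>(\<lambda>i. int m * i) ` {-int d..int d}. if int m dvd k then g (k div int m) else 0)"
  proof (intro sum.mono_neutral_right subsetI ballI)
    fix k assume "k \<in> (\<lambda>i. int m * i) ` {-int d..int d}"
    then obtain i where i: "k = int m * i" "- int d \<le> i" "i \<le> int d"
      using assms by auto
    have "int m * - int d \<le> int m * i" by (rule mult_left_mono) (use i in auto)
    moreover have "int m * i \<le> int m * int d" by (rule mult_left_mono) (use i in auto)
    ultimately show "k \<in> {-int (m * d)..int (m * d)}" using i by auto
  next
    fix k assume k: "k \<in> {-int (m * d)..int (m * d)} - (\<lambda>i. int m * i) ` {-int d..int d}"
    have False if "int m dvd k"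
    proof -
      from that obtain i where i: "k = int m * i" by blast
      then have "int m * - int d \<le> int m * i" "int m * i \<le> int m * int d" using k by auto
      then have "- int d \<le> i" "i \<le> int d"
        using assms mult_left_le_imp_le[of "int m" "- int d" i] mult_left_le_imp_le[of "int m" i "int d"]
        by auto
      then show False using k i by auto
    qed
    then show "(if int m dvd k then g (k div int m) else 0) = 0" by auto
  qed simp
  also have "\<dots> = (\<Sum>i=-int d..int d. g i)"
    by (subst sum.reindex) (use assms in \<open>auto simp: inj_on_def\<close>)
  finally show ?thesis .
qed

text \<open>The closed form is compared for \<open>q\<close> and for 1. In its first sum q-Lucas
  leaves the \<open>k\<close> with \<open>m\<close> dividing \<open>L * k\<close>; if
  \<open>m\<close> does not divide \<open>k\<close>, the geometric sum over \<open>x\<close>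
  vanishes, otherwise it equals \<open>L\<close>. Characteristic 0 allows the factor 2 to be
  cancelled.\<close>

lemma sum_reflected_root:
  fixes q :: "'a::field_char_0" and L :: int and m d :: nat
  assumes q: "q \<noteq> 0" and m: "m > 0" "\<And>i. q powi i = 1 \<longleftrightarrow> int m dvd i" and "L > 0" "d > 0"
  shows "(\<Sum>x=1..L. reflected free1 q L (int (m * d) + 1) x (2 * (m * d)) (int (m * d))) =
    (\<Sum>x=1..L. reflected free1 1 L (int d + 1) x (2 * d) (int d))" (is "?l = ?r")
proof -
  define n where "n = m * d"
  have E: "qbin q (2 * n) (int n + j) = (if int m dvd j then qbin 1 (2 * d) (int d + j div int m) else 0)" for j
  proof -
    have "qbin q (2 * n) (int n + j) = qbin q (m * (2 * d)) (int m * int d + j)"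
      by (simp add: n_def mult_ac)
    moreover have "int m dvd int m * int d + j \<longleftrightarrow> int m dvd j" by (rule dvd_add_right_iff) simp
    ultimately show ?thesis using m(1) by (simp add: qbin_mult_root[OF q m])
  qed
  have powm: "q powi i = 1" if "int m dvd i" for i using m(2) that by blast
  have V: "(\<Sum>x=1..L. q powi (k * x)) = 0" if "\<not> int m dvd k" "int m dvd L * k" for k
  proof -
    have "(q powi k - 1) * (\<Sum>x=1..L. q powi (k * x)) = (\<Sum>x=1..L. q powi (k * (x + 1)) - q powi (k * x))"
      using q by (simp add: sum_distrib_left left_diff_distrib sum_subtractf distrib_left power_int_add mult_ac)
    also have "\<dots> = q powi (k * (L + 1)) - q powi (k * 1)"
      by (rule sum_int_telescope) (use \<open>L > 0\<close> in auto)
    also have "\<dots> = 0"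
      using q powm[OF that(2)] by (simp add: distrib_left power_int_add mult.commute)
    finally show ?thesis using that(1) m(2)[of k] by auto
  qed
  have "2 * ?l = (\<Sum>k=-int n..int n. qbin q (2 * n) (int n + L * k) * (\<Sum>x=1..L. q powi (k * x)))
      - (\<Sum>j=-int n..int n. qbin q (2 * n) (int n + j))"
    unfolding n_def[symmetric]
  proof (rule sum_reflected_closed[OF q])
    have "q powi (int n) = 1" by (rule powm) (simp add: n_def)
    then show "q ^ n = 1" by simp
    show "q powi j * qbin q (2 * n) (int n + j) = qbin q (2 * n) (int n + j)" for j
      by (simp add: E powm)
  qed (use assms in \<open>auto simp: n_def\<close>)
  also have "(\<Sum>j=-int n..int n. qbin q (2 * n) (int n + j)) = (\<Sum>j=-int d..int d. qbin 1 (2 * d) (int d + j))"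
    unfolding E unfolding n_def by (rule sum_int_multiples[OF m(1)])
  also have "(\<Sum>k=-int n..int n. qbin q (2 * n) (int n + L * k) * (\<Sum>x=1..L. q powi (k * x)))
      = (\<Sum>k=-int n..int n. if int m dvd k then qbin 1 (2 * d) (int d + L * (k div int m)) * of_int L else 0)"
  proof (rule sum.cong[OF refl])
    fix k
    show "qbin q (2 * n) (int n + L * k) * (\<Sum>x=1..L. q powi (k * x)) =
        (if int m dvd k then qbin 1 (2 * d) (int d + L * (k div int m)) * of_int L else 0)"
    proof (cases "int m dvd k")
      case True
      then have "(\<Sum>x=1..L. q powi (k * x)) = of_int L"
        using \<open>L > 0\<close> by (simp add: powm)
      moreover have "L * k div int m = L * (k div int m)" using True by (simp add: div_mult_swap)
      ultimately show ?thesis using True by (simp add: E)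
    next
      case False
      then show ?thesis using V[of k] by (auto simp: E)
    qed
  qed
  also have "\<dots> = (\<Sum>k=-int d..int d. qbin 1 (2 * d) (int d + L * k) * of_int L)"
    unfolding n_def by (rule sum_int_multiples[OF m(1)])
  also have "\<dots> - (\<Sum>j=-int d..int d. qbin 1 (2 * d) (int d + j)) = 2 * ?r"
    by (subst sum_reflected_closed) (use assms in auto)
  finally show ?thesis by simp
qed

text \<open>This extends the sum over the starting heights 1..w to the full range 1..L of the closed
  form, where \<open>L = w + 2\<close>. From \<open>L - 1\<close> the last north step would start at
  height \<open>L\<close>; from \<open>L\<close> the terms for \<open>k\<close> and
  \<open>-k\<close> cancel.\<close>

lemma reflected_edge:
  assumes "q \<noteq> 0" "n > 0"
  shows "reflected free1 q L K (L - 1) (2 * n) (int n) = 0"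
    and "reflected free1 q L K L (2 * n) (int n) = 0"
proof -
  have "reflected free1 q L K (L - 1) (Suc (2 * n - 1)) (int n) = 0"
    unfolding reflected_free1_Suc by (rule reflected_top) (use assms in auto)
  then show "reflected free1 q L K (L - 1) (2 * n) (int n) = 0" using assms(2) by simp
  define Y where "Y k = q powi (L * k * k) * qbin q (2 * n - 1) (int n + L * k)" for k
  have "reflected free1 q L K L (2 * n) (int n) = (\<Sum>k=-K..K. Y (- k) - Y k)"
    unfolding reflected_def
    by (intro sum.cong refl) (use assms in \<open>auto simp: Y_def free1_def algebra_simps\<close>)
  then show "reflected free1 q L K L (2 * n) (int n) = 0"
    by (simp add: sum_subtractf sum_uminus_interval)
qed

section \<open>The path polynomial\<close>

lemma height_snoc:
  "height x (b @ [c]) = height x b + (if c = 0 then 1 else if c = 1 then -1 else 0)"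
  by (simp add: height_def)

text \<open>The height changes by one in each step, so it cannot jump over 0 or
  \<open>L\<close>.\<close>

lemma inside_iff_avoids:
  assumes "0 < x" "x < L" "set b \<subseteq> {0, 1}"
  shows "inside x L b \<longleftrightarrow> (\<forall>j\<le>length b. height x (take j b) \<noteq> 0 \<and> height x (take j b) \<noteq> L)"
  using assms(3)
proof (induction b rule: rev_induct)
  case Nil
  then show ?case using assms by (simp add: inside_def height_def)
next
  case (snoc c b)
  have "(\<forall>j\<le>length (b @ [c]). height x (take j (b @ [c])) \<noteq> 0 \<and> height x (take j (b @ [c])) \<noteq> L)
      \<longleftrightarrow> inside x L b \<and> height x (b @ [c]) \<noteq> 0 \<and> height x (b @ [c]) \<noteq> L"
    using snoc by (auto simp: le_Suc_eq all_conj_distrib)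
  also have "\<dots> \<longleftrightarrow> inside x L (b @ [c])"
    using snoc.prems inside_height[of x L b] unfolding inside_snoc by (auto simp: height_snoc)
  finally show ?case ..
qed

lemma CDP_paths_eq:
  assumes "n > 0"
  shows "CDP_paths n w = (SIGMA x:{1..int w}. strip_words x (int w + 2) (2 * n) (int n) 1)"
proof -
  have "(x, b) \<in> CDP_paths n w \<longleftrightarrow> x \<in> {1..int w} \<and> b \<in> strip_words x (int w + 2) (2 * n) (int n) 1" for x b
  proof (cases "x \<in> {1..int w} \<and> set b \<subseteq> {0, 1} \<and> length b = 2 * n \<and> count_list b 0 = n")
    case True
    have "(\<forall>j\<le>2 * n. \<forall>x' y. path_point x b j = (x', y) \<longrightarrow> y \<noteq> x' \<and> y \<noteq> x' - (int w + 2))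
        \<longleftrightarrow> (\<forall>j\<le>length b. height x (take j b) \<noteq> 0 \<and> height x (take j b) \<noteq> int w + 2)"
      using True unfolding path_point_def height_def by (auto simp: algebra_simps)
    also have "\<dots> \<longleftrightarrow> inside x (int w + 2) b"
      using True by (subst inside_iff_avoids) auto
    finally show ?thesis
      using True assms count_list_01[of b] by (auto simp: CDP_paths_def strip_words_def)
  qed (auto simp: CDP_paths_def strip_words_def)
  then show ?thesis by auto
qed

lemma CDP_paths_sum:
  fixes q :: "'a::field"
  assumes "n > 0" "q \<noteq> 0"
  shows "(\<Sum>(x, b)\<in>CDP_paths n w. q ^ maj b) =
    (\<Sum>x=1..int w + 2. reflected free1 q (int w + 2) (int n + 1) x (2 * n) (int n))"
proof -
  have "(\<Sum>(x, b)\<in>CDP_paths n w. q ^ maj b) = (\<Sum>x=1..int w. strip_sum q x (int w + 2) (2 * n) (int n) 1)"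
    unfolding CDP_paths_eq[OF assms(1)] strip_sum_def by (subst sum.Sigma) auto
  also have "\<dots> = (\<Sum>x=1..int w. reflected free1 q (int w + 2) (int n + 1) x (2 * n) (int n))"
  proof (rule sum.cong[OF refl])
    fix x assume x: "x \<in> {1..int w}"
    have "2 * int n \<le> (int w + 2) * (int n + 1) + 1" by (simp add: algebra_simps)
    then show "strip_sum q x (int w + 2) (2 * n) (int n) 1 = reflected free1 q (int w + 2) (int n + 1) x (2 * n) (int n)"
      using x assms by (intro strip_sum_reflected[THEN conjunct2]) auto
  qed
  also have "{1..int w + 2} = insert (int w + 2) (insert (int w + 2 - 1) {1..int w})" by auto
  then have "(\<Sum>x=1..int w. reflected free1 q (int w + 2) (int n + 1) x (2 * n) (int n)) =
    (\<Sum>x=1..int w + 2. reflected free1 q (int w + 2) (int n + 1) x (2 * n) (int n))"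
    using reflected_edge[OF assms(2,1), of "int w + 2"] by simp
  finally show ?thesis .
qed

lemma poly_CDP_q:
  fixes z :: complex
  assumes "n > 0"
  shows "poly (map_poly of_nat (CDP_q n w)) z = (\<Sum>(x, b)\<in>CDP_paths n w. z ^ maj b)"
proof -
  have "map_poly of_nat (CDP_q n w) = (\<Sum>(x, b)\<in>CDP_paths n w. monom (1::complex) (maj b))"
    by (rule poly_eqI) (auto simp: coeff_map_poly CDP_q_def coeff_sum case_prod_beta intro!: sum.cong)
  then show ?thesis by (simp add: poly_sum poly_monom case_prod_beta)
qed

text \<open>The path sum is a reflected sum both for \<open>m * d\<close> at \<open>q\<close> and
  for \<open>d\<close> at 1, and at 1 every path counts once.\<close>

lemma poly_CDP_q_root:
  fixes q :: complex
  assumes "q \<noteq> 0" "m > 0" "\<And>i. q powi i = 1 \<longleftrightarrow> int m dvd i" "d > 0"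
  shows "poly (map_poly of_nat (CDP_q (m * d) w)) q = of_nat (card (CDP_paths d w))"
proof -
  have "poly (map_poly of_nat (CDP_q (m * d) w)) q = (\<Sum>(x, b)\<in>CDP_paths d w. (1::complex) ^ maj b)"
  proof -
    have "m * d > 0" using assms by simp
    then have "poly (map_poly of_nat (CDP_q (m * d) w)) q =
        (\<Sum>x=1..int w + 2. reflected free1 q (int w + 2) (int (m * d) + 1) x (2 * (m * d)) (int (m * d)))"
      using assms(1) by (simp only: poly_CDP_q) (rule CDP_paths_sum)
    also have "\<dots> = (\<Sum>x=1..int w + 2. reflected free1 1 (int w + 2) (int d + 1) x (2 * d) (int d))"
      by (rule sum_reflected_root) (use assms in auto)
    finally show ?thesis using assms(4) by (subst CDP_paths_sum) auto
  qed
  also have "\<dots> = of_nat (card (CDP_paths d w))" by (simp add: case_prod_beta)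
  finally show ?thesis .
qed

section \<open>Paths and cyclic sequences\<close>

text \<open>\<open>encode x hs\<close> is the path from height \<open>x\<close> (that is, x-coordinate minus y-coordinate) whose heights
  after the successive north steps are \<open>hs\<close>.\<close>

fun encode :: "int \<Rightarrow> int list \<Rightarrow> nat list" where
  "encode x [] = []"
| "encode x (h # hs) = replicate (nat (h - x + 1)) 0 @ 1 # encode h hs"

text \<open>Guarantees that the number \<open>h - x + 1\<close> of east steps in
  \<open>encode\<close> is not truncated by \<open>nat\<close>.\<close>

fun steps :: "int \<Rightarrow> int list \<Rightarrow> bool" where
  "steps x [] \<longleftrightarrow> True"
| "steps x (h # hs) \<longleftrightarrow> x \<le> h + 1 \<and> steps h hs"

lemma inside_Cons:
  "inside x L (c # b) \<longleftrightarrow> 0 < x \<and> x < L \<and> inside (x + (if c = 0 then 1 else if c = 1 then -1 else 0)) L b"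
proof -
  have height_Cons: "height x (c # b) = height (x + (if c = 0 then 1 else if c = 1 then -1 else 0)) b" for b
    by (simp add: height_def)
  have "inside x L (c # b) \<longleftrightarrow> (0 < x \<and> x < L) \<and>
      (\<forall>j\<le>length b. 0 < height x (c # take j b) \<and> height x (c # take j b) < L)"
    unfolding inside_def less_Suc_eq_le[symmetric] by (simp add: All_less_Suc2 height_def)
  then show ?thesis unfolding height_Cons by (simp add: inside_def)
qed

text \<open>East steps only raise the height, so a positive start and the height after the last of
  them settle all heights between.\<close>

lemma inside_replicate_0:
  "0 < x \<Longrightarrow> inside x L (replicate k 0 @ b) \<longleftrightarrow> inside (x + int k) L b"
proof (induction k arbitrary: x)
  case (Suc k)
  have "inside (x + 1 + int k) L b \<Longrightarrow> x < L"
    by (auto simp: inside_def height_def dest!: spec[of _ 0])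
  with Suc show ?case by (auto simp: inside_Cons add_ac)
qed simp

lemma replicate_0_1_eq_iff:
  "replicate k (0::nat) @ 1 # b = replicate k' 0 @ 1 # b' \<longleftrightarrow> k = k' \<and> b = b'"
proof (induction k arbitrary: k')
  case 0
  then show ?case by (cases k') auto
next
  case (Suc k)
  then show ?case by (cases k') auto
qed

lemma set_encode: "set (encode x hs) \<subseteq> {0, 1}"
  by (induction hs arbitrary: x) auto

lemma count_encode: "count_list (encode x hs) 1 = length hs"
proof (induction hs arbitrary: x)
  case (Cons h hs)
  have "count_list (replicate k (0::nat)) 1 = 0" for k by (induction k) auto
  with Cons show ?case by simp
qed simp

lemma last_encode: "hs \<noteq> [] \<Longrightarrow> last (encode x hs) = 1"
proof (induction hs arbitrary: x)
  case (Cons h hs)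
  then show ?case by (cases hs) auto
qed simp

lemma height_encode: "steps x hs \<Longrightarrow> height x (encode x hs) = last (x # hs)"
proof (induction hs arbitrary: x)
  case (Cons h hs)
  have "count_list (replicate k (0::nat)) 1 = 0" "count_list (replicate k (0::nat)) 0 = k" for k
    by (induction k) auto
  with Cons.prems have "height x (encode x (h # hs)) = height h (encode h hs)"
    by (simp add: height_def)
  with Cons show ?case by simp
qed (simp add: height_def)

text \<open>Just before the north step to \<open>h\<close> the height is \<open>h + 1\<close>, so
  the bound \<open>w\<close> on recorded heights keeps the path below \<open>w + 2\<close>.\<close>

lemma inside_encode:
  "steps x hs \<Longrightarrow> set hs \<subseteq> {1..w} \<Longrightarrow> x \<in> {1..w} \<Longrightarrow> inside x (w + 2) (encode x hs)"
proof (induction hs arbitrary: x)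
  case Nil
  then show ?case by (simp add: inside_def height_def)
next
  case (Cons h hs)
  then show ?case by (simp add: inside_replicate_0 inside_Cons)
qed

lemma encode_inj:
  "encode x hs = encode x hs' \<Longrightarrow> steps x hs \<Longrightarrow> steps x hs' \<Longrightarrow> hs = hs'"
proof (induction hs arbitrary: x hs')
  case Nil
  then show ?case by (cases hs') auto
next
  case (Cons h hs)
  from Cons.prems(1) obtain h' hs'' where hs': "hs' = h' # hs''" by (cases hs') auto
  with Cons.prems(1) have *: "nat (h - x + 1) = nat (h' - x + 1)" "encode h hs = encode h' hs''"
    by (simp_all add: replicate_0_1_eq_iff[unfolded One_nat_def])
  then have "h = h'" using Cons.prems hs' by auto
  then show ?case using Cons.IH[of h hs''] Cons.prems hs' * by auto
qed

text \<open>Cutting at the first 1 splits off one run of east steps and leaves a shorter word. The 1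
  in front in the condition on \<open>last\<close> admits the empty word.\<close>

lemma encode_surj:
  assumes "set b \<subseteq> {0, 1}" "inside x (w + 2) b" "last (1 # b) = 1" "x \<in> {1..w}"
  shows "\<exists>hs. b = encode x hs \<and> set hs \<subseteq> {1..w} \<and> steps x hs"
  using assms
proof (induction "length b" arbitrary: b x rule: less_induct)
  case less
  show ?case
  proof (cases "b = []")
    case True
    then show ?thesis by (intro exI[of _ "[]"]) simp
  next
    case False
    then have "1 \<in> set b" using less.prems(3) last_in_set[OF False] by simp
    then obtain ys zs where b: "b = ys @ 1 # zs" "1 \<notin> set ys" by (meson split_list_first)
    have "\<forall>y\<in>set ys. y = 0" using b less.prems(1) by auto
    then have ys: "ys = replicate (length ys) 0" by (simp add: replicate_length_same[symmetric])
    define h where "h = x + int (length ys) - 1"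
    have "inside (x + int (length ys)) (w + 2) (1 # zs)"
      using less.prems(2,4) ys b(1) inside_replicate_0[of x "w + 2" "length ys"] by auto
    then have h: "h + 1 < w + 2" "inside h (w + 2) zs" by (auto simp: inside_Cons h_def)
    then have "h > 0" by (auto simp: inside_def height_def dest!: spec[of _ 0])
    then have hw: "h \<in> {1..w}" using h by auto
    have "\<exists>hs. zs = encode h hs \<and> set hs \<subseteq> {1..w} \<and> steps h hs"
      by (rule less.hyps) (use b less.prems h hw in auto)
    then obtain hs where hs: "zs = encode h hs" "set hs \<subseteq> {1..w}" "steps h hs" by auto
    have "b = encode x (h # hs)" using b(1) ys hs(1) by (simp add: h_def)
    then show ?thesis using hs hw by (intro exI[of _ "h # hs"]) (auto simp: h_def)
  qed
qed

text \<open>Equally many zeros and ones bring the path back to its starting height, and its final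
  step is north. The start is therefore the last recorded height, which closes the chain of
  inequalities cyclically.\<close>

lemma card_CDP_paths_cyclic:
  assumes "n > 0"
  shows "card (CDP_paths n w) = card {hs. length hs = n \<and> set hs \<subseteq> {1..int w} \<and> steps (last hs) hs}"
    (is "_ = card ?H")
proof -
  have "bij_betw (\<lambda>hs. (last hs, encode (last hs) hs)) ?H (CDP_paths n w)"
    unfolding bij_betw_def
  proof (intro conjI)
    show "inj_on (\<lambda>hs. (last hs, encode (last hs) hs)) ?H"
      by (auto simp: inj_on_def intro: encode_inj)
    show "(\<lambda>hs. (last hs, encode (last hs) hs)) ` ?H = CDP_paths n w"
    proof (intro Set.equalityI subsetI)
      fix p assume "p \<in> (\<lambda>hs. (last hs, encode (last hs) hs)) ` ?H"
      then obtain hs where hs: "p = (last hs, encode (last hs) hs)" "length hs = n"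
        "set hs \<subseteq> {1..int w}" "steps (last hs) hs" by auto
      let ?x = "last hs" and ?b = "encode (last hs) hs"
      have ne: "hs \<noteq> []" using hs assms by auto
      then have x: "?x \<in> {1..int w}" using hs(3) last_in_set by blast
      have "height ?x ?b = ?x" using height_encode[OF hs(4)] ne by simp
      then have c: "count_list ?b 0 = n" "count_list ?b 1 = n"
        using count_encode[of ?x hs] hs(2) by (auto simp: height_def)
      then have "length ?b = 2 * n" using count_list_01[OF set_encode, of ?x hs] by simp
      moreover have "?b \<noteq> []" using c assms by auto
      moreover have "inside ?x (int w + 2) ?b" using inside_encode hs x by simp
      ultimately show "p \<in> CDP_paths n w"
        unfolding CDP_paths_eq[OF assms] using hs(1) x c set_encode[of ?x hs] last_encode[OF ne, of ?x]
        by (simp add: strip_words_def)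
    next
      fix p assume "p \<in> CDP_paths n w"
      then obtain x b where p: "p = (x, b)" "x \<in> {1..int w}" "b \<in> strip_words x (int w + 2) (2 * n) (int n) 1"
        unfolding CDP_paths_eq[OF assms] by auto
      have "\<exists>hs. b = encode x hs \<and> set hs \<subseteq> {1..int w} \<and> steps x hs"
        by (rule encode_surj) (use p in \<open>auto simp: strip_words_def\<close>)
      then obtain hs where hs: "b = encode x hs" "set hs \<subseteq> {1..int w}" "steps x hs" by auto
      have c: "count_list b 0 = n" "count_list b 1 = n"
        using p(3) count_list_01[of b] by (auto simp: strip_words_def)
      then have len: "length hs = n" using hs(1) count_encode[of x hs] by simp
      then have "hs \<noteq> []" using assms by auto
      then have "last hs = x" using height_encode[OF hs(3)] c hs(1) by (simp add: height_def)
      then show "p \<in> (\<lambda>hs. (last hs, encode (last hs) hs)) ` ?H" using p(1) hs len by auto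
    qed
  qed
  then show ?thesis by (rule bij_betw_same_card[symmetric])
qed

lemma steps_nth: "steps x hs \<longleftrightarrow> (\<forall>i<length hs. (x # hs) ! i \<le> hs ! i + 1)"
  by (induction hs arbitrary: x) (auto simp: All_less_Suc2)

text \<open>Reversal turns the bound on a predecessor into one on a successor; the start
  \<open>last hs\<close>, which is \<open>a ! 0 + 1\<close>, supplies the wrap-around
  inequality.\<close>

lemma steps_rev_CDP:
  assumes "length a = n" "n > 0"
  shows "steps (last (map (\<lambda>x. x + 1) (rev a))) (map (\<lambda>x. x + 1) (rev a))
    \<longleftrightarrow> (\<forall>i<n. a ! (Suc i mod n) \<le> a ! i + 1)"
proof -
  let ?hs = "map (\<lambda>x. x + 1) (rev a)"
  have nth: "?hs ! i = a ! (n - 1 - i) + 1" if "i < n" for i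
    using that assms by (simp add: rev_nth)
  have "a \<noteq> []" using assms by auto
  then have last: "last ?hs = a ! 0 + 1"
    by (simp add: last_map last_rev hd_conv_nth)
  have shifted: "(last ?hs # ?hs) ! i = a ! (Suc (n - 1 - i) mod n) + 1" if "i < n" for i
  proof (cases i)
    case 0
    then show ?thesis using last assms by simp
  next
    case (Suc j)
    then have "Suc (n - 1 - i) = n - 1 - j" "n - 1 - j < n" using that by auto
    then show ?thesis using nth[of j] that Suc by simp
  qed
  have "steps (last ?hs) ?hs \<longleftrightarrow> (\<forall>i<n. a ! (Suc (n - 1 - i) mod n) \<le> a ! (n - 1 - i) + 1)"
    unfolding steps_nth using assms nth shifted by (simp add: add.commute)
  also have "\<dots> \<longleftrightarrow> (\<forall>i<n. a ! (Suc i mod n) \<le> a ! i + 1)"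
  proof (intro iffI allI impI)
    fix i assume *: "\<forall>i<n. a ! (Suc (n - 1 - i) mod n) \<le> a ! (n - 1 - i) + 1" "i < n"
    then show "a ! (Suc i mod n) \<le> a ! i + 1" using *(1)[rule_format, of "n - 1 - i"] by simp
  qed auto
  finally show ?thesis .
qed

lemma card_CDP:
  assumes "n > 0"
  shows "card (CDP n w) = card (CDP_paths n w)"
proof -
  let ?H = "{hs. length hs = n \<and> set hs \<subseteq> {1..int w} \<and> steps (last hs) hs}"
  let ?f = "\<lambda>a::int list. map (\<lambda>x. x + 1) (rev a)"
  have mem: "a \<in> CDP n w \<longleftrightarrow> ?f a \<in> ?H" for a
  proof (cases "length a = n")
    case True
    have "(\<forall>i<n. 0 \<le> a ! i \<and> a ! i \<le> int w - 1) \<longleftrightarrow> (\<forall>x\<in>set a. 0 \<le> x \<and> x \<le> int w - 1)"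
      using True by (simp add: all_set_conv_all_nth)
    also have "\<dots> \<longleftrightarrow> set (?f a) \<subseteq> {1..int w}" by auto
    finally show ?thesis
      using True by (simp add: CDP_def steps_rev_CDP[OF True assms])
  qed (simp add: CDP_def)
  have "bij_betw ?f (CDP n w) ?H"
  proof (rule bij_betw_byWitness[where f' = "\<lambda>hs. rev (map (\<lambda>x. x - 1) hs)"])
    show "(\<lambda>hs. rev (map (\<lambda>x. x - 1) hs)) ` ?H \<subseteq> CDP n w"
      unfolding image_subset_iff mem by (simp add: comp_def)
    show "?f ` CDP n w \<subseteq> ?H" unfolding image_subset_iff using mem by blast
  qed (simp_all add: comp_def rev_map)
  then show ?thesis unfolding card_CDP_paths_cyclic[OF assms] by (rule bij_betw_same_card)
qed

section \<open>The cyclic shift\<close>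

text \<open>On nonempty lists \<open>cyc_shift\<close> and \<open>rotate1\<close> are inverse to
  each other, so powers of the shift and their fixed points reduce to rotations.\<close>

lemma rotate1_cyc_shift: "a \<noteq> [] \<Longrightarrow> rotate1 (cyc_shift a) = a"
  by (simp add: cyc_shift_def)

lemma cyc_shift_rotate1: "a \<noteq> [] \<Longrightarrow> cyc_shift (rotate1 a) = a"
  by (cases a) (auto simp: cyc_shift_def)

lemma cyc_shift_neq_Nil: "a \<noteq> [] \<Longrightarrow> cyc_shift a \<noteq> []"
  by (simp add: cyc_shift_def)

lemma cyc_shift_pow_rotate: "a \<noteq> [] \<Longrightarrow> (cyc_shift ^^ k) (rotate k a) = a"
proof (induction k arbitrary: a)
  case (Suc k)
  have "(cyc_shift ^^ Suc k) (rotate (Suc k) a) = (cyc_shift ^^ k) (cyc_shift (rotate1 (rotate k a)))"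
    by (simp only: funpow_Suc_right comp_apply rotate_Suc)
  then show ?case using Suc by (simp add: cyc_shift_rotate1)
qed simp

lemma rotate_cyc_shift_pow: "a \<noteq> [] \<Longrightarrow> rotate k ((cyc_shift ^^ k) a) = a"
proof (induction k arbitrary: a)
  case (Suc k)
  have ne: "(cyc_shift ^^ k) a \<noteq> []"
    using Suc.prems by (induction k) (auto simp: cyc_shift_neq_Nil)
  have "rotate (Suc k) ((cyc_shift ^^ Suc k) a) = rotate k (rotate1 (cyc_shift ((cyc_shift ^^ k) a)))"
    by (simp add: rotate1_rotate_swap)
  then show ?case using Suc ne by (simp add: rotate1_cyc_shift)
qed simp

lemma cyc_shift_pow_eq_rotate:
  assumes "length a = n" "n > 0"
  shows "(cyc_shift ^^ k) a = rotate (n - k mod n) a"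
proof -
  have ne: "a \<noteq> []" using assms by auto
  have "rotate (k + (n - k mod n)) a = a"
  proof -
    have "(k + (n - k mod n)) mod n = ((k mod n) + (n - k mod n)) mod n" by (simp add: mod_add_left_eq)
    also have "\<dots> = 0" using assms(2) by (simp add: less_imp_le)
    finally show ?thesis using assms(1) by (simp add: rotate_id)
  qed
  then have "(cyc_shift ^^ k) a = (cyc_shift ^^ k) (rotate k (rotate (n - k mod n) a))"
    by (simp add: rotate_rotate)
  then show ?thesis using ne by (simp add: cyc_shift_pow_rotate)
qed

lemma rotate_CDP:
  assumes "a \<in> CDP n w" "n > 0"
  shows "rotate k a \<in> CDP n w"
proof -
  have len: "length a = n" using assms by (simp add: CDP_def)
  have nth: "rotate k a ! i = a ! ((k + i) mod n)" if "i < n" for i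
    using that len by (simp add: nth_rotate)
  have "rotate k a ! (Suc i mod n) \<le> rotate k a ! i + 1" if "i < n" for i
  proof -
    have "rotate k a ! (Suc i mod n) = a ! (Suc ((k + i) mod n) mod n)"
      using assms(2) by (simp add: nth mod_simps)
    then show ?thesis using assms that by (simp add: nth CDP_def)
  qed
  then show ?thesis using assms len nth by (auto simp: CDP_def)
qed

lemma cyc_shift_pow_CDP:
  assumes "a \<in> CDP n w" "n > 0"
  shows "(cyc_shift ^^ k) a \<in> CDP n w"
proof -
  have "length a = n" using assms by (simp add: CDP_def)
  then show ?thesis using rotate_CDP[OF assms] by (simp add: cyc_shift_pow_eq_rotate[OF _ assms(2)])
qed

lemma cyc_shift_pow_mod:
  assumes "length a = n" "n > 0"
  shows "(cyc_shift ^^ (k mod n)) a = (cyc_shift ^^ k) a"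
  using cyc_shift_pow_eq_rotate[OF assms] by simp

lemma cyc_shift_pow_fixed_iff:
  assumes "a \<noteq> []"
  shows "(cyc_shift ^^ k) a = a \<longleftrightarrow> rotate k a = a"
  using cyc_shift_pow_rotate[OF assms, of k] rotate_cyc_shift_pow[OF assms, of k] by metis

section \<open>The action of the cyclic group\<close>

lemma finite_CDP: "finite (CDP n w)"
proof (rule finite_subset)
  show "CDP n w \<subseteq> {a. set a \<subseteq> {0..int w - 1} \<and> length a = n}"
    by (auto simp: CDP_def in_set_conv_nth)
qed (simp add: finite_lists_length_eq)

text \<open>Addition modulo \<open>n\<close> becomes composition because the \<open>n\<close>-th
  power of the shift is the identity on lists of length \<open>n\<close>.\<close>

lemma CDP_group_action:
  assumes "n > 0"
  shows "group_action (integer_mod_group n) (CDP n w) (CDP_action n w)"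
proof -
  have ne: "a \<noteq> []" "length a = n" if "a \<in> CDP n w" for a using that assms by (auto simp: CDP_def)
  have Bij: "CDP_action n w k \<in> Bij (CDP n w)" for k
  proof -
    have "bij_betw (cyc_shift ^^ nat k) (CDP n w) (CDP n w)"
      by (rule bij_betw_byWitness[where f' = "rotate (nat k)"])
        (use assms ne in \<open>auto simp: rotate_cyc_shift_pow cyc_shift_pow_rotate cyc_shift_pow_CDP rotate_CDP\<close>)
    then show ?thesis by (simp add: Bij_def CDP_action_def bij_betw_restrict_eq)
  qed
  have mult: "CDP_action n w ((x + y) mod int n) = compose (CDP n w) (CDP_action n w x) (CDP_action n w y)"
    if "0 \<le> x" "0 \<le> y" for x y
  proof
    fix a
    show "CDP_action n w ((x + y) mod int n) a = compose (CDP n w) (CDP_action n w x) (CDP_action n w y) a"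
    proof (cases "a \<in> CDP n w")
      case True
      have "nat ((x + y) mod int n) = (nat x + nat y) mod n"
        using that by (simp add: nat_mod_distrib nat_add_distrib)
      then show ?thesis
        using True assms ne[OF True]
        by (simp add: CDP_action_def compose_def cyc_shift_pow_mod cyc_shift_pow_CDP funpow_add)
    qed (simp add: CDP_action_def compose_def)
  qed
  have "CDP_action n w \<in> hom (integer_mod_group n) (BijGroup (CDP n w))"
    using assms Bij mult
    by (auto simp: hom_def BijGroup_def carrier_integer_mod_group)
  then show ?thesis
    by (simp add: group_action_def group_hom_def group_hom_axioms_def group_BijGroup)
qed

lemma generate_integer_mod_group:
  assumes "n > 0"
  shows "generate (integer_mod_group n) {1 mod int n} = carrier (integer_mod_group n)"
proof -
  have "1 mod int n \<in> carrier (integer_mod_group n)"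
    using assms by (simp add: carrier_integer_mod_group)
  then have "generate (integer_mod_group n) {1 mod int n} = {k * (1 mod int n) mod int n | k. k \<in> (UNIV :: int set)}"
    by (subst group.generate_pow) (auto simp: int_pow_integer_mod_group)
  also have "\<dots> = carrier (integer_mod_group n)"
  proof (intro Set.equalityI subsetI)
    fix x assume "x \<in> carrier (integer_mod_group n)"
    then have "x = x * (1 mod int n) mod int n"
      using assms by (simp add: carrier_integer_mod_group mod_simps)
    then show "x \<in> {k * (1 mod int n) mod int n | k. k \<in> (UNIV :: int set)}" by blast
  qed (use assms in \<open>auto simp: carrier_integer_mod_group\<close>)
  finally show ?thesis .
qed

section \<open>Fixed sequences and powers of the root of unity\<close>

lemma rotate_mult_fixed: "rotate k a = a \<Longrightarrow> rotate (k * t) a = a"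
  by (induction t) (auto simp: rotate_rotate[symmetric])

text \<open>By Bezout the gcd is a multiple of \<open>k\<close> modulo the length.\<close>

lemma rotate_gcd_fixed:
  assumes "rotate k a = a" "k > 0"
  shows "rotate (gcd k (length a)) a = a"
proof -
  obtain x y where xy: "k * x = length a * y + gcd k (length a)"
    using bezout_nat[of k "length a"] assms(2) by auto
  have "rotate (gcd k (length a)) a = rotate (k * x) a"
    unfolding xy by (subst (1 2) rotate_conv_mod) simp
  then show ?thesis using rotate_mult_fixed[OF assms(1)] by simp
qed

lemma rotate_fixed_nth:
  assumes "rotate d a = a" "d > 0" "i < length a"
  shows "a ! i = a ! (i mod d)"
proof -
  have "i mod d < length a" using assms(3) by (meson le_less_trans mod_less_eq_dividend)
  then have "rotate (d * (i div d)) a ! (i mod d) = a ! ((d * (i div d) + i mod d) mod length a)"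
    by (rule nth_rotate)
  then show ?thesis using rotate_mult_fixed[OF assms(1)] assms(3) by simp
qed

text \<open>A fixed sequence has period \<open>gcd k n\<close>. Its first period determines it, and
  periodic extension inverts the restriction.\<close>

lemma card_CDP_fixed:
  assumes "n > 0" "k > 0"
  shows "card {a \<in> CDP n w. rotate k a = a} = card (CDP (gcd k n) w)"
proof -
  define d where "d = gcd k n"
  have d: "d > 0" "d dvd n" "d dvd k" "d \<le> n" using assms by (auto simp: d_def gcd_le2_nat)
  have mod_d: "i mod n mod d = i mod d" for i using d(2) by (simp add: mod_mod_cancel)
  let ?F = "{a \<in> CDP n w. rotate k a = a}"
  let ?e = "\<lambda>b::int list. map (\<lambda>i. b ! (i mod d)) [0..<n]"
  have per: "a ! i = a ! (i mod d)" "length a = n" if "a \<in> ?F" "i < n" for a i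
  proof -
    show "length a = n" using that by (simp add: CDP_def)
    then show "a ! i = a ! (i mod d)"
      using rotate_gcd_fixed[of k a] rotate_fixed_nth[of d a i] that assms d(1) by (auto simp: d_def)
  qed
  have "bij_betw (take d) ?F (CDP d w)"
  proof (rule bij_betw_byWitness[where f' = ?e])
    show "\<forall>a\<in>?F. ?e (take d a) = a"
    proof
      fix a assume a: "a \<in> ?F"
      then have "length a = n" by (simp add: CDP_def)
      then show "?e (take d a) = a"
        using d(1) per(1)[OF a] by (intro nth_equalityI) auto
    qed
    show "\<forall>b\<in>CDP d w. take d (?e b) = b"
      using d by (auto simp: CDP_def intro!: nth_equalityI)
    show "take d ` ?F \<subseteq> CDP d w"
    proof (intro image_subsetI)
      fix a assume a: "a \<in> ?F"
      have "a ! (Suc i mod d) \<le> a ! i + 1" if "i < d" for i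
      proof -
        \<comment> \<open>As \<open>d\<close> divides \<open>n\<close>, reducing modulo
          \<open>n\<close> first is harmless; this covers the wrap-around at
          \<open>i = d - 1\<close>.\<close>
        have "a ! (Suc i mod n) = a ! (Suc i mod d)"
          using per(1)[OF a, of "Suc i mod n"] assms mod_d by simp
        moreover have "a ! (Suc i mod n) \<le> a ! i + 1" using a that d(4) by (auto simp: CDP_def)
        ultimately show ?thesis by simp
      qed
      then show "take d a \<in> CDP d w"
        using a d by (auto simp: CDP_def)
    qed
    show "?e ` CDP d w \<subseteq> ?F"
    proof (intro image_subsetI)
      fix b assume b: "b \<in> CDP d w"
      have "rotate k (?e b) = ?e b"
      proof (rule nth_equalityI)
        fix i assume "i < length (rotate k (?e b))"
        then have i: "i < n" by simp
        have "(k + i) mod d = i mod d" using d(3) by (auto elim!: dvdE)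
        then show "rotate k (?e b) ! i = ?e b ! i"
          using i assms mod_d by (simp add: nth_rotate)
      qed simp
      moreover have "?e b \<in> CDP n w"
      proof -
        have "b ! (Suc i mod n mod d) \<le> b ! (i mod d) + 1" for i
        proof -
          have "b ! (Suc (i mod d) mod d) \<le> b ! (i mod d) + 1" using b d(1) by (simp add: CDP_def)
          then show ?thesis by (simp add: mod_d mod_Suc_eq)
        qed
        moreover have "0 \<le> b ! (i mod d) \<and> b ! (i mod d) \<le> int w - 1" for i
          using b d(1) by (simp add: CDP_def)
        ultimately show ?thesis using assms by (simp add: CDP_def)
      qed
      ultimately show "?e b \<in> ?F" by simp
    qed
  qed
  then show ?thesis unfolding d_def by (rule bij_betw_same_card)
qed

text \<open>The \<open>k\<close>-th power of a primitive \<open>n\<close>-th root of unity has order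
  \<open>n div gcd k n\<close>, since this number is coprime to
  \<open>k div gcd k n\<close>.\<close>

lemma root_unity_powi_eq_1_iff:
  assumes "n > 0" "k > 0"
  shows "(exp (2 * complex_of_real pi * \<i> / of_nat n) ^ k) powi i = 1 \<longleftrightarrow> int (n div gcd k n) dvd i"
proof -
  let ?q = "exp (2 * complex_of_real pi * \<i> / of_nat n) ^ k"
  have "?q ^ j = 1 \<longleftrightarrow> n div gcd k n dvd j" for j
  proof -
    have "?q ^ j = exp (2 * complex_of_real pi * \<i> * of_nat (k * j) / of_nat n)"
      by (simp flip: exp_of_nat_mult power_mult add: field_simps)
    then have "?q ^ j = 1 \<longleftrightarrow> n dvd k * j" using complex_root_unity_eq_1[of n "k * j"] assms by simp
    also have "\<dots> \<longleftrightarrow> gcd k n * (n div gcd k n) dvd gcd k n * (k div gcd k n * j)"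
      by (simp add: mult.assoc[symmetric])
    also have "\<dots> \<longleftrightarrow> n div gcd k n dvd k div gcd k n * j" 
      using assms by (intro dvd_times_left_cancel_iff) simp
    also have "\<dots> \<longleftrightarrow> n div gcd k n dvd j"
      using div_gcd_coprime[of k n] assms
      by (intro coprime_dvd_mult_right_iff) (simp add: coprime_commute)
    finally show ?thesis .
  qed
  then show ?thesis
    by (cases i rule: int_cases2) (simp_all add: power_int_minus)
qed

theorem theorem4p1:
  fixes n w :: nat
  assumes "n \<ge> 1" and "w \<ge> 1"
  shows "exhibits_CSP (CDP n w) (integer_mod_group n) n (1 mod int n) (CDP_action n w) (CDP_q n w)"
proof -
  have n: "n > 0" using assms by simp
  have "poly (map_poly of_nat (CDP_q n w)) (exp (2 * complex_of_real pi * \<i> / of_nat n) ^ k)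
      = of_nat (card {a \<in> CDP n w. CDP_action n w ((1 mod int n) [^]\<^bsub>integer_mod_group n\<^esub> k) a = a})"
    if k: "k \<in> {1..n}" for k
  proof -
    let ?d = "gcd k n" and ?q = "exp (2 * complex_of_real pi * \<i> / of_nat n) ^ k"
    have d: "?d > 0" "n div ?d > 0" "n div ?d * ?d = n" using n by (auto simp: div_greater_zero_iff gcd_le2_nat)
    \<comment> \<open>Writing \<open>n\<close> as the order of \<open>?q\<close> times
      \<open>?d\<close> brings the polynomial into the form evaluated by
      \<open>poly_CDP_q_root\<close>.\<close>
    have "poly (map_poly of_nat (CDP_q (n div ?d * ?d) w)) ?q = of_nat (card (CDP_paths ?d w))"
      using n k d root_unity_powi_eq_1_iff[of n k] by (intro poly_CDP_q_root) auto
    also have "card (CDP_paths ?d w) = card {a \<in> CDP n w. rotate k a = a}"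
      using n k d by (simp add: card_CDP_fixed card_CDP)
    also have "{a \<in> CDP n w. rotate k a = a} =
        {a \<in> CDP n w. CDP_action n w ((1 mod int n) [^]\<^bsub>integer_mod_group n\<^esub> k) a = a}"
    proof (rule Collect_cong, rule conj_cong[OF refl])
      fix a assume a: "a \<in> CDP n w"
      then have "length a = n" "a \<noteq> []" using n by (auto simp: CDP_def)
      moreover have "nat (int k mod int n) = k mod n" by (simp add: nat_mod_distrib)
      ultimately show "(rotate k a = a) =
          (CDP_action n w ((1 mod int n) [^]\<^bsub>integer_mod_group n\<^esub> k) a = a)"
        using a n by (simp add: CDP_action_def mod_simps cyc_shift_pow_mod cyc_shift_pow_fixed_iff)
    qed
    finally show ?thesis using d by simp
  qed
  then show ?thesis
    unfolding exhibits_CSP_def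
    using n finite_CDP CDP_group_action generate_integer_mod_group
    by (simp add: Coset.order_def carrier_integer_mod_group)
qed

end
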